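(* Let $F$ be a finite field, let $n>1$ be an integer, let $1\le k_1<\cdots<k_r\le n$ be integers with $1\le r\le n-1$, let $S=\bigsqcup_{i=1}^rV_{k_i}\subset M_n(F)$, and let $k_{\max}=k_r$. Then for any two distinct non-adjacent vertices $A,B$ of the graph $\Gamma(M_n(F),S)$, the distance between $A$ and $B$ is $$d(A,B)=\max\left\{2,\left\lceil\frac{\operatorname{rank}(B-A)}{k_{\max}}\right\rceil\right\}.$$
   Context: For $1\le k\le n$, $V_k$ denotes the set of all matrices of rank $k$ in the ring $M_n(F)$ of $n\times n$ matrices over $F$. $\Gamma(M_n(F),S)$ denotes the graph with vertex set $M_n(F)$ in which two vertices $X,Y$ are adjacent if $X-Y\in S$. The distance $d(A,B)$ is the length of a shortest path from $A$ to $B$. *)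

theory Defs
  imports "HOL-Analysis.Analysis" "Graph_Theory.Pair_Digraph" "HOL-Library.Extended_Nat"
begin

definition rank_class :: "nat \<Rightarrow> (('a::field)^'n^'n) set" where
  "rank_class k = {X. rank X = k}"

text \<open>
  Following \<^theory>\<open>Graph_Theory.Digraph\<close>, an undirected graph is represented by a digraph with a
  symmetric arc relation. The arc relation below is symmetric whenever \<open>S\<close> is closed under
  negation, as is every union of rank classes, and it has no loops if \<open>S\<close> does not contain \<open>0\<close>.
\<close>

definition matrix_graph ::
  "(('a::field)^'n^'n) set \<Rightarrow> ('a^'n^'n, ('a^'n^'n) \<times> ('a^'n^'n)) pre_digraph" where
  "matrix_graph S = with_proj \<lparr>pverts = UNIV, parcs = {(X, Y). X - Y \<in> S}\<rparr>"

text \<open>A path is the list of its arcs, so its length is the length of the list. The infimum over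
  the empty set is \<open>\<infinity>\<close>, so the distance is finite exactly if the vertices are joined by a path.\<close>

definition graph_distance :: "('v, 'e) pre_digraph \<Rightarrow> 'v \<Rightarrow> 'v \<Rightarrow> enat" where
  "graph_distance G u v = (INF p \<in> {p. pre_digraph.apath G u p v}. enat (length p))"

end

theory Submission
  imports Defs
begin

text \<open>
  The rank is subadditive, so a walk of length \<open>q\<close> only reaches matrices whose difference from the
  starting point has rank at most \<open>q\<close> times the largest admissible rank \<open>k\<close>. Conversely, a difference
  of rank \<open>m > 2k\<close> is shortened by splitting off a block of rank \<open>k\<close>, and a difference of rank
  \<open>m \<le> 2k\<close> with \<open>m \<noteq> k\<close> is a sum of two matrices of rank \<open>k\<close>. For the latter, choose bases in which the
  matrix is a partial identity and subtract a cyclic permutation block if \<open>m < k\<close>, or a nilpotent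
  block plus an identity block if \<open>m > k\<close>. These work over every field, including the field with two
  elements.
\<close>

section \<open>Bases adapted to a linear map\<close>

abbreviation linear_map :: "('a::field^'n \<Rightarrow> 'a^'m) \<Rightarrow> bool" where
  "linear_map \<equiv> Vector_Spaces.linear (*s) (*s)"

text \<open>The normal form needs bases listed with a distinguished part first; the remaining
  elements are matched with the remaining indices by counting.\<close>

lemma extend_enumeration:
  assumes "finite B" and inj: "inj_on \<beta> {..<m}" and sub: "\<beta> ` {..<m} \<subseteq> B"
  obtains b where "bij_betw b {..<card B} B" and "\<And>i. i < m \<Longrightarrow> b i = \<beta> i"
proof -
  have m: "m \<le> card B"
    using card_mono[OF \<open>finite B\<close> sub] card_image[OF inj] by simp
  have "card (B - \<beta> ` {..<m}) = card {m..<card B}"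
    using card_Diff_subset[OF _ sub] card_image[OF inj] by simp
  then obtain \<gamma> where \<gamma>: "bij_betw \<gamma> {m..<card B} (B - \<beta> ` {..<m})"
    using finite_same_card_bij[of "{m..<card B}" "B - \<beta> ` {..<m}"] \<open>finite B\<close> by auto
  define b where "b i = (if i < m then \<beta> i else \<gamma> i)" for i
  have "bij_betw b {..<m} (\<beta> ` {..<m})"
    using inj by (auto simp: bij_betw_def b_def inj_on_def)
  moreover have "bij_betw b {m..<card B} (B - \<beta> ` {..<m})"
    using \<gamma> by (subst bij_betw_cong[of _ _ \<gamma>]) (auto simp: b_def)
  ultimately have "bij_betw b ({..<m} \<union> {m..<card B}) (\<beta> ` {..<m} \<union> (B - \<beta> ` {..<m}))"
    by (rule bij_betw_combine) auto
  moreover have "{..<m} \<union> {m..<card B} = {..<card B}" "\<beta> ` {..<m} \<union> (B - \<beta> ` {..<m}) = B"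
    using m sub by auto
  ultimately show thesis
    using that[of b] by (auto simp: b_def)
qed

lemma card_vec_basis:
  fixes B :: "('a::field^'n) set"
  assumes "vec.independent B" "vec.span B = UNIV"
  shows "card B = CARD('n)"
  using assms by (metis vec.dim_span_eq_card_independent vec_dim_card)

text \<open>A basis \<open>K\<close> of the kernel extends to a basis \<open>B\<close>, and
  \<open>f\<close> maps \<open>E = B - K\<close> injectively onto a basis of the range, which
  extends to a basis \<open>C\<close>. Listing \<open>E\<close> first in \<open>B\<close>, and its
  images in the same order in \<open>C\<close>, turns \<open>f\<close> into a partial
  identity.\<close>

lemma linear_map_normal_form:
  fixes f :: "'a::field^'n \<Rightarrow> 'a^'n"
  assumes lf: "linear_map f"
  obtains b c :: "nat \<Rightarrow> 'a^'n"
  where "inj_on b {..<CARD('n)}" "vec.independent (b ` {..<CARD('n)})"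
    and "inj_on c {..<CARD('n)}" "vec.independent (c ` {..<CARD('n)})"
    and "vec.dim (range f) \<le> CARD('n)"
    and "\<And>i. i < CARD('n) \<Longrightarrow> f (b i) = (if i < vec.dim (range f) then c i else 0)"
proof -
  obtain K where K: "K \<subseteq> {x. f x = 0}" "vec.independent K" "{x. f x = 0} \<subseteq> vec.span K"
    using vec.basis_exists[of "{x. f x = 0}"] by metis
  define B where "B = vec.extend_basis K"
  have B: "K \<subseteq> B" "vec.independent B" "vec.span B = UNIV"
    using vec.extend_basis_superset[OF K(2)] vec.independent_extend_basis[OF K(2)]
      vec.span_extend_basis[OF K(2)] by (auto simp: B_def)
  have cB: "finite B" "card B = CARD('n)"
    using vec.finiteI_independent[OF B(2)] card_vec_basis[OF B(2,3)] by simp_all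
  define E where "E = B - K"
  have iE: "vec.independent E"
    unfolding E_def by (rule vec.independent_mono[OF B(2) Diff_subset])
  have inj: "inj_on f (vec.span E)"
    unfolding vec.linear_inj_on_iff_eq_0[OF lf vec.subspace_span]
  proof safe
    fix x assume x: "x \<in> vec.span E" and "f x = 0"
    then have xK: "x \<in> vec.span K" using K by auto
    \<comment> \<open>The coordinates of \<open>x\<close> are supported both in \<open>E\<close> and
      in \<open>K\<close>, which are disjoint.\<close>
    have "vec.representation B x v = 0" for v
    proof (rule ccontr)
      assume "vec.representation B x v \<noteq> 0"
      moreover have "vec.representation B x = vec.representation E x"
        using vec.representation_extend[OF B(2) x] by (auto simp: E_def)
      moreover have "vec.representation B x = vec.representation K x"
        using vec.representation_extend[OF B(2) xK] B by auto
      ultimately have "v \<in> E" "v \<in> K"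
        using vec.representation_ne_zero by metis+
      then show False by (auto simp: E_def)
    qed
    then show "x = 0"
      using vec.sum_nonzero_representation_eq[OF B(2), of x] B(3) by simp
  qed
  have ifE: "vec.independent (f ` E)"
    by (rule vec.linear_independent_injective_image[OF lf iE inj])
  have injE: "inj_on f E"
    using inj vec.span_superset by (rule inj_on_subset)
  have "vec.span (f ` E) = range f"
  proof -
    have "range f = f ` vec.span (E \<union> K)"
      using B by (simp add: E_def Un_absorb2)
    also have "\<dots> = vec.span (f ` E \<union> f ` K)"
      by (metis vec.linear_span_image[OF lf] image_Un)
    also have "\<dots> = vec.span (f ` E)"
    proof (rule vec.span_eq[THEN iffD2], intro conjI Un_least subsetI)
      fix y assume "y \<in> f ` K"
      with K(1) show "y \<in> vec.span (f ` E)" by (auto simp: vec.span_zero)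
    qed (auto intro: vec.span_base)
    finally show ?thesis ..
  qed
  then have cE: "card E = vec.dim (range f)"
    using vec.dim_span_eq_card_independent[OF ifE] card_image[OF injE] by simp
  obtain \<beta> where \<beta>: "bij_betw \<beta> {..<card E} E"
    using cB ex_bij_betw_nat_finite[of E] by (auto simp: E_def atLeast0LessThan)
  obtain b where b: "bij_betw b {..<card B} B" "\<And>i. i < card E \<Longrightarrow> b i = \<beta> i"
    using extend_enumeration[of B \<beta> "card E"] cB(1) \<beta> 
    by (metis B(1) Diff_subset E_def bij_betw_def)
  define C where "C = vec.extend_basis (f ` E)"
  have C: "f ` E \<subseteq> C" "vec.independent C" "vec.span C = UNIV"
    using vec.extend_basis_superset[OF ifE] vec.independent_extend_basis[OF ifE]
      vec.span_extend_basis[OF ifE] by (auto simp: C_def)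
  have cC: "finite C" "card C = CARD('n)"
    using vec.finiteI_independent[OF C(2)] card_vec_basis[OF C(2,3)] by simp_all
  have "inj_on (f \<circ> \<beta>) {..<card E}" "(f \<circ> \<beta>) ` {..<card E} \<subseteq> C"
    using \<beta> injE C(1) by (auto simp: bij_betw_def intro: comp_inj_on)
  then obtain c where c: "bij_betw c {..<card C} C" "\<And>i. i < card E \<Longrightarrow> c i = (f \<circ> \<beta>) i"
    using extend_enumeration[OF cC(1)] by blast
  have "f (b i) = (if i < card E then c i else 0)" if "i < CARD('n)" for i
  proof (cases "i < card E")
    case False
    \<comment> \<open>The indices below \<open>card E\<close> already exhaust \<open>E\<close>, so
      every later basis vector lies in the kernel part \<open>K\<close>.\<close>
    have "b i \<notin> b ` {..<card E}"
      using b(1) False that cB card_mono[of B E] unfolding bij_betw_def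
      by (subst inj_on_image_mem_iff[of b "{..<card B}"]) (auto simp: E_def)
    also have "b ` {..<card E} = E"
      using b(2) \<beta> by (auto simp: bij_betw_def)
    finally have "b i \<in> K"
      using b(1) that cB by (auto simp: bij_betw_def E_def)
    with K False show ?thesis by auto
  qed (use b c in simp)
  moreover have "vec.dim (range f) \<le> CARD('n)"
    by (rule dim_subset_UNIV_cart_gen)
  ultimately show thesis
    using that[of b c] b(1) c(1) B C cB cC cE by (auto simp: bij_betw_def)
qed

lemma linear_map_on_basis:
  fixes x :: "nat \<Rightarrow> 'a::field^'n"
  assumes "inj_on b {..<CARD('n)}" "vec.independent (b ` {..<CARD('n)})"
  obtains g :: "'a^'n \<Rightarrow> 'a^'n" where "linear_map g" "\<And>i. i < CARD('n) \<Longrightarrow> g (b i) = x i"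
proof -
  obtain g where "linear_map g"
    "\<forall>v\<in>b ` {..<CARD('n)}. g v = x (the_inv_into {..<CARD('n)} b v)"
    using vec.linear_independent_extend[OF assms(2),
        of "\<lambda>v. x (the_inv_into {..<CARD('n)} b v)"] by blast
  then show thesis
    using that[of g] by (auto simp: the_inv_into_f_f[OF assms(1)])
qed

text \<open>The range of \<open>g\<close> is spanned by its values on the basis \<open>b\<close>.
  The assumptions \<open>sub\<close> and \<open>sup\<close> equate this span with that of the
  independent family \<open>c\<close> on \<open>I\<close>, so ranks below are found by naming
  \<open>I\<close>.\<close>

lemma dim_range_on_basis:
  fixes g :: "'a::field^'n \<Rightarrow> 'a^'n"
  assumes b: "inj_on b {..<CARD('n)}" "vec.independent (b ` {..<CARD('n)})"
    and c: "inj_on c {..<CARD('n)}" "vec.independent (c ` {..<CARD('n)})"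
    and I: "I \<subseteq> {..<CARD('n)}"
    and lg: "linear_map g"
    and sub: "\<And>i. i < CARD('n) \<Longrightarrow> g (b i) \<in> vec.span (c ` I)"
    and sup: "\<And>i. i \<in> I \<Longrightarrow> c i \<in> vec.span ((\<lambda>i. g (b i)) ` {..<CARD('n)})"
  shows "vec.dim (range g) = card I"
proof -
  have "vec.span (b ` {..<CARD('n)}) = UNIV"
    using b card_image[OF b(1)] vec.card_ge_dim_independent[OF subset_UNIV b(2)]
    by (auto simp: card_cart_basis)
  then have "range g = vec.span (g ` b ` {..<CARD('n)})"
    by (simp add: vec.linear_span_image[OF lg])
  also have "\<dots> = vec.span (c ` I)"
    using sub sup by (intro vec.span_eq[THEN iffD2]) (auto simp: image_image)
  finally show ?thesis
    using vec.dim_span_eq_card_independent[of "c ` I"] vec.independent_mono[OF c(2), of "c ` I"]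
      card_image[OF inj_on_subset[OF c(1) I]] I by auto
qed

section \<open>Splitting a linear map into two summands of prescribed rank\<close>

lemma linear_map_split_summand:
  fixes f :: "'a::field^'n \<Rightarrow> 'a^'n"
  assumes lf: "linear_map f" and k: "k \<le> vec.dim (range f)"
  obtains g where "linear_map g" "vec.dim (range g) = k"
    and "vec.dim (range (\<lambda>v. f v - g v)) = vec.dim (range f) - k"
proof -
  define m where "m = vec.dim (range f)"
  obtain b c :: "nat \<Rightarrow> 'a^'n" where b: "inj_on b {..<CARD('n)}" "vec.independent (b ` {..<CARD('n)})"
    and c: "inj_on c {..<CARD('n)}" "vec.independent (c ` {..<CARD('n)})"
    and m: "m \<le> CARD('n)" and f: "\<And>i. i < CARD('n) \<Longrightarrow> f (b i) = (if i < m then c i else 0)"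
    using linear_map_normal_form[OF lf] unfolding m_def by blast
  \<comment> \<open>Of the \<open>m\<close> diagonal ones of \<open>f\<close>, the map
    \<open>g\<close> keeps the first \<open>k\<close>, and the difference keeps the other
    \<open>m - k\<close>.\<close>
  obtain g :: "'a^'n \<Rightarrow> 'a^'n" where lg: "linear_map g"
    and g: "\<And>i. i < CARD('n) \<Longrightarrow> g (b i) = (if i < k then c i else 0)"
    using linear_map_on_basis[OF b, of "\<lambda>i. if i < k then c i else 0"] by blast
  have lh: "linear_map (\<lambda>v. f v - g v)"
    by (rule vec.linear_compose_sub[OF lf lg])
  have "k \<le> m" using k m_def by simp
  have "vec.dim (range g) = card {..<k}"
  proof (rule dim_range_on_basis[OF b c _ lg])
    fix i assume "i \<in> {..<k}"
    then show "c i \<in> vec.span ((\<lambda>i. g (b i)) ` {..<CARD('n)})"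
      using \<open>k \<le> m\<close> m by (intro vec.span_base image_eqI[of _ _ i]) (auto simp: g)
  qed (use \<open>k \<le> m\<close> m in \<open>auto simp: g intro!: vec.span_base vec.span_zero\<close>)
  moreover have "vec.dim (range (\<lambda>v. f v - g v)) = card {k..<m}"
  proof (rule dim_range_on_basis[OF b c _ lh])
    fix i assume "i \<in> {k..<m}"
    then show "c i \<in> vec.span ((\<lambda>i. f (b i) - g (b i)) ` {..<CARD('n)})"
      using m by (intro vec.span_base image_eqI[of _ _ i]) (auto simp: f g)
  qed (use \<open>k \<le> m\<close> m in \<open>auto simp: f g intro!: vec.span_base vec.span_zero\<close>)
  ultimately show thesis
    using that[OF lg] by (simp add: m_def)
qed

lemma linear_map_sum_two_below:
  fixes f :: "'a::field^'n \<Rightarrow> 'a^'n"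
  assumes lf: "linear_map f" and k: "vec.dim (range f) < k" "k \<le> CARD('n)"
  obtains g where "linear_map g" "vec.dim (range g) = k" "vec.dim (range (\<lambda>v. f v - g v)) = k"
proof -
  define m where "m = vec.dim (range f)"
  obtain b c :: "nat \<Rightarrow> 'a^'n" where b: "inj_on b {..<CARD('n)}" "vec.independent (b ` {..<CARD('n)})"
    and c: "inj_on c {..<CARD('n)}" "vec.independent (c ` {..<CARD('n)})"
    and f: "\<And>i. i < CARD('n) \<Longrightarrow> f (b i) = (if i < m then c i else 0)"
    using linear_map_normal_form[OF lf] unfolding m_def by blast
  \<comment> \<open>The cyclic permutation matrix of size k: subtracting it from an idempotent diagonal matrix of
    rank m < k leaves an invertible block, over every field.\<close>
  define x where "x i = (if Suc i < k then c (Suc i) else if Suc i = k then c 0 else 0)" for i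
  obtain g :: "'a^'n \<Rightarrow> 'a^'n" where lg: "linear_map g"
    and g: "\<And>i. i < CARD('n) \<Longrightarrow> g (b i) = x i"
    using linear_map_on_basis[OF b, of x] by blast
  have lh: "linear_map (\<lambda>v. f v - g v)"
    by (rule vec.linear_compose_sub[OF lf lg])
  have mk: "m < k" "\<not> k - 1 < m" using k m_def by simp_all
  have I: "{..<k} \<subseteq> {..<CARD('n)}" using k by auto
  have x_span: "x i \<in> vec.span (c ` {..<k})" for i
    using mk by (auto simp: x_def intro!: vec.span_base vec.span_zero)
  have "vec.dim (range g) = card {..<k}"
  proof (rule dim_range_on_basis[OF b c I lg])
    fix i assume "i \<in> {..<k}"
    then have "\<exists>j < CARD('n). g (b j) = c i"
    proof (cases i)
      case 0
      then show ?thesis using k mk by (intro exI[of _ "k - 1"]) (auto simp: g x_def)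
    next
      case (Suc j)
      with \<open>i \<in> {..<k}\<close> show ?thesis using k by (intro exI[of _ j]) (auto simp: g x_def)
    qed
    then show "c i \<in> vec.span ((\<lambda>i. g (b i)) ` {..<CARD('n)})"
      by (metis image_eqI lessThan_iff vec.span_base)
  qed (simp add: g x_span)
  moreover have "vec.dim (range (\<lambda>v. f v - g v)) = card {..<k}"
  proof (rule dim_range_on_basis[OF b c I lh])
    fix i assume "i < CARD('n)"
    then show "f (b i) - g (b i) \<in> vec.span (c ` {..<k})"
      using mk by (auto simp: f g intro!: vec.span_diff vec.span_neg x_span intro: vec.span_base)
  next
    let ?H = "vec.span ((\<lambda>i. f (b i) - g (b i)) ` {..<CARD('n)})"
    have h: "(if i < m then c i else 0) - x i \<in> ?H" if "i < k" for i
      using that k by (intro vec.span_base image_eqI[of _ _ i]) (auto simp: f g)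
    fix i assume "i \<in> {..<k}"
    then have "i < k" by simp
    then show "c i \<in> ?H"
    proof (induction i)
      case 0
      \<comment> \<open>At the last index \<open>k - 1\<close> of the cycle \<open>f\<close>
        vanishes, because \<open>m < k\<close>. The difference there is \<open>- c 0\<close>, which
        starts the induction.\<close>
      show ?case
        using vec.span_neg[OF h[of "k - 1"]] mk by (simp add: x_def)
    next
      case (Suc i)
      \<comment> \<open>The contribution of \<open>f\<close> at \<open>i\<close> is
        \<open>c i\<close>, known by induction, or zero; removing the difference at \<open>i\<close>
        from it leaves \<open>x i = c (Suc i)\<close>.\<close>
      then have "(if i < m then c i else 0) - ((if i < m then c i else 0) - x i) \<in> ?H"
        by (intro vec.span_diff h) (auto intro: vec.span_zero)
      then show ?case
        using Suc.prems by (simp add: x_def)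
    qed
  qed
  ultimately show thesis
    using that[OF lg] by simp
qed

lemma linear_map_sum_two_above:
  fixes f :: "'a::field^'n \<Rightarrow> 'a^'n"
  assumes lf: "linear_map f" and k: "k < vec.dim (range f)" "vec.dim (range f) \<le> 2 * k"
  obtains g where "linear_map g" "vec.dim (range g) = k" "vec.dim (range (\<lambda>v. f v - g v)) = k"
proof -
  define m where "m = vec.dim (range f)"
  obtain b c :: "nat \<Rightarrow> 'a^'n" where b: "inj_on b {..<CARD('n)}" "vec.independent (b ` {..<CARD('n)})"
    and c: "inj_on c {..<CARD('n)}" "vec.independent (c ` {..<CARD('n)})"
    and m: "m \<le> CARD('n)" and f: "\<And>i. i < CARD('n) \<Longrightarrow> f (b i) = (if i < m then c i else 0)"
    using linear_map_normal_form[OF lf] unfolding m_def by blast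
  \<comment> \<open>In the two bases, f is the partial identity of rank m. The first summand is a nilpotent k by k block
    of rank k - t plus an identity block of size t; the second one is a unipotent block of size k.\<close>
  define t where "t = m - k"
  \<comment> \<open>The bound \<open>2 * k\<close> on the rank enters as \<open>t \<le> k\<close>,
    so that the shift by \<open>t\<close> fits into the block of size \<open>k\<close>.\<close>
  have t: "0 < t" "t \<le> k" "m = k + t"
    using k by (auto simp: t_def m_def)
  define x where "x i = (if i < t then 0 else if i < k then c (i - t) else if i < m then c i else 0)" for i
  obtain g :: "'a^'n \<Rightarrow> 'a^'n" where lg: "linear_map g"
    and g: "\<And>i. i < CARD('n) \<Longrightarrow> g (b i) = x i"
    using linear_map_on_basis[OF b, of x] by blast
  have lh: "linear_map (\<lambda>v. f v - g v)"
    by (rule vec.linear_compose_sub[OF lf lg])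
  \<comment> \<open>The shift reaches the first \<open>k - t\<close> vectors of \<open>c\<close>,
    and the identity block the \<open>t\<close> vectors from \<open>k\<close> to
    \<open>m - 1\<close>.\<close>
  have "vec.dim (range g) = card ({..<k - t} \<union> {k..<m})"
  proof (rule dim_range_on_basis[OF b c _ lg])
    show "{..<k - t} \<union> {k..<m} \<subseteq> {..<CARD('n)}"
      using m t by auto
    show "g (b i) \<in> vec.span (c ` ({..<k - t} \<union> {k..<m}))" if "i < CARD('n)" for i
      using that t by (auto simp: g x_def intro!: vec.span_base vec.span_zero)
    fix i assume i: "i \<in> {..<k - t} \<union> {k..<m}"
    have "\<exists>j < CARD('n). g (b j) = c i"
    proof (cases "i < k")
      case True
      with i m t show ?thesis by (intro exI[of _ "i + t"]) (auto simp: g x_def)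
    next
      case False
      with i m t show ?thesis by (intro exI[of _ i]) (auto simp: g x_def)
    qed
    then show "c i \<in> vec.span ((\<lambda>i. g (b i)) ` {..<CARD('n)})"
      by (metis image_eqI lessThan_iff vec.span_base)
  qed
  also have "\<dots> = k"
    using t by (subst card_Un_disjoint) auto
  finally have "vec.dim (range g) = k" .
  moreover have "vec.dim (range (\<lambda>v. f v - g v)) = card {..<k}"
  proof (rule dim_range_on_basis[OF b c _ lh])
    show "{..<k} \<subseteq> {..<CARD('n)}"
      using m t by auto
    \<comment> \<open>From index \<open>k\<close> on, \<open>g\<close> agrees with \<open>f\<close>,
      so the difference vanishes there.\<close>
    show "f (b i) - g (b i) \<in> vec.span (c ` {..<k})" if "i < CARD('n)" for i
      using that t by (auto simp: f g x_def intro!: vec.span_diff intro: vec.span_base vec.span_zero)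
    let ?H = "vec.span ((\<lambda>i. f (b i) - g (b i)) ` {..<CARD('n)})"
    have h: "c i - x i \<in> ?H" if "i < k" for i
      using that m t by (intro vec.span_base image_eqI[of _ _ i]) (auto simp: f g)
    fix i assume "i \<in> {..<k}"
    then have "i < k" by simp
    then show "c i \<in> ?H"
    proof (induction i rule: less_induct)
      case (less i)
      \<comment> \<open>Below \<open>k\<close>, \<open>x i\<close> is zero or
        \<open>c (i - t)\<close>, whose index is smaller because \<open>t\<close> is
        positive.\<close>
      have "x i \<in> ?H"
        using less t by (auto simp: x_def intro: vec.span_zero)
      from vec.span_add[OF h[OF less.prems] this] show ?case by simp
    qed
  qed
  ultimately show thesis
    using that[OF lg] by simp
qed

section \<open>From linear maps to ranks of matrices\<close>

text \<open>Here \<open>rank\<close> is the dimension of the row space. The rows of \<open>A\<close>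
  are the columns of its transpose, and these span the range of the transpose.\<close>

lemma rank_eq_dim_range:
  fixes A :: "'a::field^'n^'m"
  shows "rank A = vec.dim (range ((*v) (transpose A)))"
proof -
  have "vec.span (range ((*v) (transpose A))) = vec.span (rows A)"
  proof (rule vec.span_eq[THEN iffD2], safe)
    show "transpose A *v x \<in> vec.span (rows A)" for x
      using matrix_vector_mult_in_columnspace_gen[of "transpose A" x] by simp
    fix v assume "v \<in> rows A"
    then obtain i where "v = column i (transpose A)"
      by (auto simp: rows_def)
    then have "v = transpose A *v axis i 1"
      by (simp add: vec_eq_iff matrix_vector_mult_def column_def axis_def if_distrib cong: if_cong)
    then show "v \<in> vec.span (range ((*v) (transpose A)))"
      by (auto intro: vec.span_base)
  qed
  then show ?thesis
    unfolding row_rank_def_gen by (metis vec.dim_span)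
qed

lemma transpose_diff: "transpose (A - B) = transpose A - transpose (B :: 'a::ab_group_add^'n^'m)"
  by (simp add: transpose_def vec_eq_iff)

text \<open>This carries a splitting of the map of \<open>transpose C\<close> over to
  \<open>C\<close>: the summand is the transpose of the matrix of \<open>g\<close>.\<close>

lemma obtain_summand_of_rank:
  fixes C :: "'a::field^'n^'n"
  assumes "\<exists>g. linear_map g \<and> vec.dim (range g) = k \<and>
    vec.dim (range (\<lambda>v. transpose C *v v - g v)) = l"
  obtains X where "rank X = k" "rank (C - X) = l"
proof -
  obtain g where g: "linear_map g" "vec.dim (range g) = k"
    "vec.dim (range (\<lambda>v. transpose C *v v - g v)) = l"
    using assms by blast
  have "rank (transpose (matrix g)) = k" "rank (C - transpose (matrix g)) = l"
    using g by (simp_all add: rank_eq_dim_range transpose_diff matrix_works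
        matrix_vector_mult_diff_rdistrib cong: image_cong)
  then show thesis by (rule that)
qed

text \<open>Rank exactly \<open>k\<close> must be excluded: over the field with two elements, the 1
  by 1 matrix 1 is not a sum of two nonzero matrices.\<close>

lemma rank_sum_two:
  fixes C :: "'a::field^'n^'n"
  assumes "rank C \<noteq> k" "rank C \<le> 2 * k" "k \<le> CARD('n)"
  obtains X where "rank X = k" "rank (C - X) = k"
proof (rule obtain_summand_of_rank[of k C k])
  show "\<exists>g. linear_map g \<and> vec.dim (range g) = k \<and>
    vec.dim (range (\<lambda>v. transpose C *v v - g v)) = k"
  proof (cases "rank C < k")
    case True
    show ?thesis
      by (rule linear_map_sum_two_below[OF matrix_vector_mul_linear_gen, of "transpose C" k])
        (use True assms in \<open>auto simp: rank_eq_dim_range\<close>)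
  next
    case False
    show ?thesis
      by (rule linear_map_sum_two_above[OF matrix_vector_mul_linear_gen, of k "transpose C"])
        (use False assms in \<open>auto simp: rank_eq_dim_range\<close>)
  qed
qed (rule that)

lemma rank_split_summand:
  fixes C :: "'a::field^'n^'n"
  assumes "k \<le> rank C"
  obtains X where "rank X = k" "rank (C - X) = rank C - k"
proof (rule obtain_summand_of_rank[of k C "rank C - k"])
  show "\<exists>g. linear_map g \<and> vec.dim (range g) = k \<and>
    vec.dim (range (\<lambda>v. transpose C *v v - g v)) = rank C - k"
    by (rule linear_map_split_summand[OF matrix_vector_mul_linear_gen, of k "transpose C"])
      (use assms in \<open>auto simp: rank_eq_dim_range\<close>)
qed (rule that)

lemma rank_add_le:
  fixes A B :: "'a::field^'n^'m"
  shows "rank (A + B) \<le> rank A + rank B"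
proof -
  obtain U where U: "vec.independent U" "rows A \<subseteq> vec.span U" "card U = rank A"
    using vec.basis_exists[of "rows A"] unfolding row_rank_def_gen by metis
  obtain V where V: "vec.independent V" "rows B \<subseteq> vec.span V" "card V = rank B"
    using vec.basis_exists[of "rows B"] unfolding row_rank_def_gen by metis
  have "rows (A + B) \<subseteq> vec.span (U \<union> V)"
  proof
    fix v assume "v \<in> rows (A + B)"
    then obtain i where "v = row i A + row i B"
      by (auto simp: rows_def row_def vec_eq_iff)
    moreover have "row i A \<in> vec.span (U \<union> V)" "row i B \<in> vec.span (U \<union> V)"
      using U V vec.span_mono[of U "U \<union> V"] vec.span_mono[of V "U \<union> V"]
      by (auto simp: rows_def)
    ultimately show "v \<in> vec.span (U \<union> V)"
      by (simp add: vec.span_add)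
  qed
  then have "rank (A + B) \<le> card (U \<union> V)"
    unfolding row_rank_def_gen
    by (rule vec.dim_le_card) (use U V vec.finiteI_independent in auto)
  with U V card_Un_le[of U V] show ?thesis by simp
qed

lemma rank_eq_0_iff:
  fixes A :: "'a::field^'n^'m"
  shows "rank A = 0 \<longleftrightarrow> A = 0"
  unfolding row_rank_def_gen vec.dim_eq_0
  by (auto simp: rows_def row_def vec_eq_iff subset_iff)

lemma rank_uminus:
  fixes A :: "'a::field^'n^'m"
  shows "rank (- A) = rank A"
proof -
  have "rank (- A) \<le> rank A" for A :: "'a^'n^'m"
  proof -
    have "rows (- A) \<subseteq> vec.span (rows A)"
    proof
      fix v assume "v \<in> rows (- A)"
      then obtain i where "v = - row i A"
        by (auto simp: rows_def row_def vec_eq_iff)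
      then show "v \<in> vec.span (rows A)"
        by (auto simp: rows_def intro!: vec.span_neg intro: vec.span_base)
    qed
    then show ?thesis
      unfolding row_rank_def_gen by (metis vec.dim_mono)
  qed
  from this[of A] this[of "- A"] show ?thesis by simp
qed

section \<open>Walks in the matrix graph\<close>

lemma verts_matrix_graph [simp]: "verts (matrix_graph S) = UNIV"
  and arcs_matrix_graph [simp]: "arcs (matrix_graph S) = {(X, Y). X - Y \<in> S}"
  and tail_matrix_graph [simp]: "tail (matrix_graph S) = fst"
  and head_matrix_graph [simp]: "head (matrix_graph S) = snd"
  and dominates_matrix_graph [simp]: "X \<rightarrow>\<^bsub>matrix_graph S\<^esub> Y \<longleftrightarrow> X - Y \<in> S"
  by (simp_all add: matrix_graph_def)

lemma wf_digraph_matrix_graph: "wf_digraph (matrix_graph S)"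
  by unfold_locales auto

text \<open>The difference \<open>A - B\<close> telescopes along the walk into one element of
  \<open>S\<close> per arc.\<close>

lemma rank_diff_le_length_awalk:
  fixes S :: "('a::field^'n^'n) set"
  assumes "\<And>X. X \<in> S \<Longrightarrow> rank X \<le> k" and "pre_digraph.awalk (matrix_graph S) A p B"
  shows "rank (A - B) \<le> length p * k"
  using assms(2)
proof (induction p arbitrary: A)
  case Nil
  then show ?case
    by (simp add: wf_digraph.awalk_Nil_iff[OF wf_digraph_matrix_graph] rank_eq_0_iff)
next
  case (Cons e p)
  then have e: "A - snd e \<in> S" and "pre_digraph.awalk (matrix_graph S) (snd e) p B"
    by (auto simp: wf_digraph.awalk_Cons_iff[OF wf_digraph_matrix_graph])
  with Cons.IH have "rank (snd e - B) \<le> length p * k" by blast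
  moreover have "rank (A - snd e) \<le> k" using e assms(1) by blast
  ultimately show ?case
    using rank_add_le[of "A - snd e" "snd e - B"] by simp
qed

text \<open>All arcs used have rank \<open>k\<close>. The lower bound on the rank for
  \<open>q > 2\<close> lets each step split off rank \<open>k\<close> and still leave a remainder
  above \<open>k\<close>, until two arcs finish the walk.\<close>

lemma exists_awalk_matrix_graph:
  fixes S :: "('a::field^'n^'n) set"
  assumes S: "rank_class k \<subseteq> S" and k: "k \<le> CARD('n)"
    and "2 \<le> q" and "rank (A - B) \<noteq> k" "rank (A - B) \<le> q * k"
    and "q = 2 \<or> (q - 1) * k < rank (A - B)"
  shows "\<exists>p. pre_digraph.awalk (matrix_graph S) A p B \<and> length p = q"
  using assms(3-)
proof (induction q arbitrary: A rule: nat_induct_at_least)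
  case base
  then obtain X where "rank X = k" "rank (A - B - X) = k"
    using rank_sum_two[of "A - B" k] k by auto
  then have "X \<in> S" "A - X - B \<in> S"
    using S by (auto simp: rank_class_def algebra_simps)
  then have "pre_digraph.awalk (matrix_graph S) A [(A, A - X), (A - X, B)] B"
    by (auto simp: wf_digraph.awalk_simps[OF wf_digraph_matrix_graph])
  then show ?case by (metis One_nat_def Suc_1 length_Cons list.size(3))
next
  case (Suc q)
  \<comment> \<open>Since \<open>Suc q\<close> is at least 3, the lower bound on the rank must
    hold.\<close>
  have less: "(q - 1) * k + k < rank (A - B)"
    using Suc.prems(3) \<open>2 \<le> q\<close> by (cases q) auto
  then obtain X where X: "rank X = k" "rank (A - B - X) = rank (A - B) - k"
    using rank_split_summand[of k "A - B"] by auto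
  have eq: "rank ((A - X) - B) = rank (A - B) - k"
    using X by (simp add: algebra_simps)
  \<comment> \<open>This keeps the remaining rank strictly above \<open>k\<close>, hence away from
    the excluded value.\<close>
  have "1 * k \<le> (q - 1) * k"
    using \<open>2 \<le> q\<close> by (intro mult_right_mono) auto
  then have "rank (A - B) - k \<noteq> k" "rank (A - B) - k \<le> q * k" "(q - 1) * k < rank (A - B) - k"
    using Suc.prems(2) less unfolding mult_1 mult_Suc by linarith+
  then obtain p where "pre_digraph.awalk (matrix_graph S) (A - X) p B" "length p = q"
    using Suc.IH[of "A - X"] unfolding eq by blast
  moreover have "X \<in> S"
    using X S by (auto simp: rank_class_def)
  ultimately have "pre_digraph.awalk (matrix_graph S) A ((A, A - X) # p) B"
    "length ((A, A - X) # p) = Suc q"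
    by (auto simp: wf_digraph.awalk_Cons_iff[OF wf_digraph_matrix_graph])
  then show ?case by blast
qed

section \<open>From walks to the graph distance\<close>

text \<open>Cutting out closed subwalks never lengthens a walk. This bridges the walks constructed
  above and the paths over which \<open>graph_distance\<close> takes its infimum.\<close>

lemma (in wf_digraph) awalk_imp_shorter_apath:
  assumes "awalk u p v"
  shows "\<exists>p'. apath u p' v \<and> length p' \<le> length p"
  using assms
proof (induction p rule: awalk_to_apath_induct)
  case (path p)
  then show ?case by (auto simp: apath_def)
next
  case (decomp p q r s)
  then show ?case
    using awalk_cyc_decomp_has_prop[of u p v] by fastforce
qed

lemma graph_distance_eqI:
  assumes "wf_digraph G" "pre_digraph.awalk G u p v" "length p = d"
    and "\<And>p. pre_digraph.awalk G u p v \<Longrightarrow> d \<le> length p"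
  shows "graph_distance G u v = enat d"
proof (rule antisym)
  interpret wf_digraph G by fact
  obtain p' where "apath u p' v" "length p' \<le> d"
    using awalk_imp_shorter_apath[OF assms(2)] assms(3) by blast
  then show "graph_distance G u v \<le> enat d"
    unfolding graph_distance_def by (intro INF_lower2[of p']) auto
  show "enat d \<le> graph_distance G u v"
    unfolding graph_distance_def using assms(4) by (intro INF_greatest) (auto simp: apath_def)
qed

theorem theorem3p13:
  fixes k :: "nat \<Rightarrow> nat" and r k_max :: nat
    and S :: "(('a::{field,finite})^'n^'n) set"
    and A B :: "'a^'n^'n"
  assumes "CARD('n) > 1"
    and "1 \<le> r" and "r \<le> CARD('n) - 1"
    and "strict_mono_on {1..r} k"
    and "\<forall>i\<in>{1..r}. 1 \<le> k i \<and> k i \<le> CARD('n)"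
    and "S = (\<Union>i\<in>{1..r}. rank_class (k i))"
    and "k_max = k r"
    and "A \<noteq> B"
    and "\<not> A \<rightarrow>\<^bsub>matrix_graph S\<^esub> B"
  shows "graph_distance (matrix_graph S) A B =
           enat (max 2 (nat \<lceil>real (rank (B - A)) / real k_max\<rceil>))"
proof -
  interpret wf_digraph "matrix_graph S" by (rule wf_digraph_matrix_graph)
  define m where "m = rank (A - B)"
  have m_eq: "rank (B - A) = m"
    using rank_uminus[of "A - B"] by (simp add: m_def)
  define c where "c = nat \<lceil>real m / real k_max\<rceil>"
  have k_max: "1 \<le> k_max" "k_max \<le> CARD('n)" and "rank_class k_max \<subseteq> S"
    using assms(2,5,6,7) by auto
  have notin: "A - B \<notin> S" using assms(9) by simp
  \<comment> \<open>Non-adjacency rules out the one rank for which a sum of two summands may fail to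
    exist.\<close>
  then have "m \<noteq> k_max"
    using \<open>rank_class k_max \<subseteq> S\<close> by (auto simp: m_def rank_class_def)
  \<comment> \<open>This characterizes \<open>c\<close> as the least \<open>q\<close> with
    \<open>m \<le> q * k_max\<close> and removes the ceiling from the rest of the argument.\<close>
  have c_le: "c \<le> q \<longleftrightarrow> m \<le> q * k_max" for q
  proof -
    have "c \<le> q \<longleftrightarrow> real m / real k_max \<le> real q"
      unfolding c_def by (simp add: nat_le_iff ceiling_le_iff)
    also have "\<dots> \<longleftrightarrow> real m \<le> real (q * k_max)"
      using k_max by (simp add: pos_divide_le_eq)
    finally show ?thesis unfolding of_nat_le_iff .
  qed
  have rank_S: "rank X \<le> k_max" if X: "X \<in> S" for X
  proof -
    obtain i where "i \<in> {1..r}" "rank X = k i"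
      using X assms(6) by (auto simp: rank_class_def)
    then show ?thesis
      using strict_mono_on_leD[OF assms(4), of i r] assms(2,7) by auto
  qed
  have "m \<le> max 2 c * k_max" using c_le[of "max 2 c"] by simp
  \<comment> \<open>If \<open>c > 2\<close>, then minimality of \<open>c\<close> makes the bound
    fail for \<open>c - 1\<close>.\<close>
  moreover have "max 2 c = 2 \<or> (max 2 c - 1) * k_max < m"
    using c_le[of "c - 1"] by (auto simp: max_def not_le)
  ultimately obtain p where "awalk A p B" "length p = max 2 c"
    using exists_awalk_matrix_graph[OF \<open>rank_class k_max \<subseteq> S\<close> k_max(2), of "max 2 c" A B] \<open>m \<noteq> k_max\<close>
    by (auto simp: m_def)
  moreover have "max 2 c \<le> length p" if p: "awalk A p B" for p
  proof -
    have "length p \<noteq> 0" using p \<open>A \<noteq> B\<close> by (auto simp: awalk_Nil_iff)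
    \<comment> \<open>A walk of length one would be an arc from \<open>A\<close> to
      \<open>B\<close>.\<close>
    moreover have "length p \<noteq> 1"
      using p notin by (auto simp: length_Suc_conv awalk_simps)
    moreover have "c \<le> length p"
      using rank_diff_le_length_awalk[OF rank_S p] by (simp add: c_le m_def)
    ultimately show ?thesis by linarith
  qed
  ultimately have "graph_distance (matrix_graph S) A B = enat (max 2 c)"
    by (intro graph_distance_eqI wf_digraph_matrix_graph)
  then show ?thesis by (simp add: c_def m_eq)
qed

end
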